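(* Let $\mathbb S=\{s\in\mathbb R^m: Cs\succeq_{\mathcal C} d\}$ and, for $s\in\mathbb S$, $\mathbb X(s)=\{x\in\mathbb R^n: Wx\succeq_{\mathcal K}Hs+h\}$, where $\mathcal C,\mathcal K$ are proper convex cones, and assume that $\Xi=\{(s,x): Cs\succeq_{\mathcal C} d,\ Wx\succeq_{\mathcal K}Hs+h\}$ admits a Slater point. Let $\Psi=(\Psi_1,\dots,\Psi_{D}):\mathbb R^n\to\mathbb R^{D}$ be a feature map with convex components satisfying $$\|(s_1,\Psi(x_1))-(s_2,\Psi(x_2))\|\le\|(s_1,x_1)-(s_2,x_2)\|\qquad\forall (s_1,x_1),(s_2,x_2)\in\mathbb R^m\times\mathbb R^n,$$ and consider the convex hypotheses $F_\theta(s,x)=\langle\theta,\Psi(x)\rangle$ with $\theta$ ranging over a convex closed search space $\Theta\subseteq\mathbb R_+^{D}$. Let $\ell_\theta(s,x)=F_\theta(s,x)-\min_{y\in\mathbb X(s)}F_\theta(s,y)$ be the suboptimality loss, $\alpha\in(0,1]$, $\varepsilon\ge0$, and let $(\hat s_i,\hat x_i)\in\mathbb R^m\times\mathbb R^n$, $i\le N$, be training samples (not necessarily in $\Xi$) with empirical distribution $\hat{\mathbb P}_N$. Then the following convex program provides a safe approximation for the distributionally robust inverse optimization problem $\min_{\theta\in\Theta}\sup_{\mathbb Q\in\mathbb B^1_\varepsilon(\hat{\mathbb P}_N)}\mathrm{CVaR}^{\mathbb Q}_\alpha(\ell_\theta)$ over the $1$-Wasserstein ball: $$\begin{array}{lll}\text{minimize}&\displaystyle\tau+\frac1\alpha\Big(\varepsilon\lambda+\frac1N\sum_{i=1}^N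 r_i\Big)\\ \text{subject to}&\theta\in\Theta,\ \lambda\in\mathbb R_+,\ \tau,r_i\in\mathbb R,\ \phi_{i1},\phi_{i2}\in\mathcal C^*,\ \gamma_i\in\mathcal K^*,\ z_{ij}\in\mathbb R^n&\forall i\le N,\ \forall j\le D\\ &\displaystyle\sum_{j=1}^{D}\theta_j\Psi_j^*(z_{ij}/\theta_j)+\langle\theta,\Psi(\hat x_i)\rangle+\langle\phi_{i1},C\hat s_i-d\rangle-\langle\gamma_i,H\hat s_i+h\rangle\le r_i+\tau&\forall i\le N\\ &\displaystyle\sum_{j=1}^{D}z_{ij}=W^\top\gamma_i&\forall i\le N\\ &\langle C\hat s_i-d,\phi_{i2}\rangle\le r_i&\forall i\le N\\ &\left\|\begin{pmatrix}H^\top\gamma_i-C^\top\phi_{i1}\\ \theta\end{pmatrix}\right\|_*\le\lambda,\quad\left\|\begin{pmatrix}C^\top\phi_{i2}\\0\end{pmatrix}\right\|_*\le\lambda&\forall i\le N.\end{array}$$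
   Context: A proper convex cone is closed, solid and pointed; $s\succeq_{\mathcal C}t$ means $s-t\in\mathcal C$; $\mathcal C^*=\{t:\langle t,s\rangle\ge0\ \forall s\in\mathcal C\}$. $D$ denotes the dimension of the feature space, whereas $d$ is the right-hand-side vector in the description of $\mathbb S$. $\|\cdot\|$ denotes a norm on the signal-response space $\mathbb R^m\times\mathbb R^n$ and likewise a norm on the signal-feature space $\mathbb R^m\times\mathbb R^{D}$; $\|\cdot\|_*$ in the program is the dual norm $\|t\|_*=\sup_{\|s\|\le1}\langle t,s\rangle$ of the latter. The conjugate of $f:\mathbb R^n\to\mathbb R$ is $f^*(z)=\sup_{x\in\mathbb R^n}\langle z,x\rangle-f(x)$. For $\theta_j=0$ the expression $\theta_j\Psi_j^*(z_{ij}/\theta_j)$ is interpreted as $0$ if $z_{ij}=0$ and $+\infty$ otherwise. $\hat{\mathbb P}_N=\frac1N\sum_{i=1}^N\delta_{(\hat s_i,\hat x_i)}$. $\mathrm{CVaR}^{\mathbb Q}_\alpha(\ell)=\inf_{\tau\in\mathbb R}\ \tau+\frac1\alpha\mathbb E^{\mathbb Q}[\max\{\ell(s,x)-\tau,0\}]$. $\mathcal M^1(\Xi)$ is the set of probability distributions $\mathbb Q$ supported on $\Xi$ with $\mathbb E^{\mathbb Q}[\|\xi\|]<\infty$; $W_1(\mathbb Q_1,\mathbb Q_2)$ is the infimum of $\int\|\xi_1-\xi_2\|\,\Pi(d\xi_1,d\xi_2)$ over joint distributions $\Pi$ with marginals $\mathbb Q_1,\mathbb Q_2$; $\mathbb B^1_\varepsilon(\hat{\mathbb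 P}_N)=\{\mathbb Q\in\mathcal M^1(\Xi):W_1(\mathbb Q,\hat{\mathbb P}_N)\le\varepsilon\}$. "Safe approximation" means conservative: for each $\theta\in\Theta$, the infimum of the convex program over the remaining variables is an upper bound on the worst-case risk $\sup_{\mathbb Q\in\mathbb B^1_\varepsilon(\hat{\mathbb P}_N)}\mathrm{CVaR}^{\mathbb Q}_\alpha(\ell_\theta)$.
   Formalization: The displayed program can be unsafe for general norms. Its safety is proved when the signal-feature norm is unchanged under s → −s; for arbitrary norms, safety is proved with H^⊤γ_i − C^⊤φ_{i1} replaced by C^⊤φ_{i1} − H^⊤γ_i in the dual-norm constraint. *)

theory Defs
  imports "HOL-Probability.Probability_Measure"
begin

section \<open>Cones and norms\<close>

definition dual_cone :: "'a::real_inner set \<Rightarrow> 'a set"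
  where "dual_cone K = {t. \<forall>s\<in>K. t \<bullet> s \<ge> 0}"

definition proper_cone :: "'a::euclidean_space set \<Rightarrow> bool"
  where "proper_cone K \<longleftrightarrow>
    convex_cone K \<and> closed K \<and> interior K \<noteq> {} \<and> (\<forall>t. t \<in> K \<and> - t \<in> K \<longrightarrow> t = 0)"

text \<open>An arbitrary norm, unrelated in general to the Euclidean \<^const>\<open>norm\<close> of the type.
  Nonnegativity follows from the three conditions.\<close>

definition is_norm :: "('a::real_vector \<Rightarrow> real) \<Rightarrow> bool"
  where "is_norm N \<longleftrightarrow>
    (\<forall>v. N v = 0 \<longleftrightarrow> v = 0) \<and>
    (\<forall>c v. N (c *\<^sub>R v) = \<bar>c\<bar> * N v) \<and>
    (\<forall>v w. N (v + w) \<le> N v + N w)"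

text \<open>For a norm on a Euclidean space the supremum is over a nonempty bounded set of reals.\<close>

definition dual_norm :: "('a::euclidean_space \<Rightarrow> real) \<Rightarrow> 'a \<Rightarrow> real"
  where "dual_norm N t = (SUP s\<in>{s. N s \<le> 1}. t \<bullet> s)"

definition flip_fst :: "('a::real_vector \<times> 'b \<Rightarrow> real) \<Rightarrow> 'a \<times> 'b \<Rightarrow> real"
  where "flip_fst N = (\<lambda>(u, v). N (- u, v))"

lemma dual_norm_flip_fst:
  fixes N :: "'a::euclidean_space \<times> 'b::euclidean_space \<Rightarrow> real"
  shows "dual_norm (flip_fst N) (u, v) = dual_norm N (- u, v)"
proof -
  have "(\<lambda>s. (u, v) \<bullet> s) ` {s. flip_fst N s \<le> 1} = (\<lambda>s. (- u, v) \<bullet> s) ` {s. N s \<le> 1}"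
    (is "?L = ?R")
  proof
    show "?L \<subseteq> ?R"
    proof
      fix a assume "a \<in> ?L"
      then obtain p q where "N (- p, q) \<le> 1" "a = (u, v) \<bullet> (p, q)"
        by (auto simp: flip_fst_def)
      then show "a \<in> ?R" by (intro image_eqI[of _ _ "(- p, q)"]) auto
    qed
    show "?R \<subseteq> ?L"
    proof
      fix a assume "a \<in> ?R"
      then obtain p q where "N (p, q) \<le> 1" "a = (- u, v) \<bullet> (p, q)"
        by auto
      then show "a \<in> ?L"
        by (intro image_eqI[of _ _ "(- p, q)"]) (auto simp: flip_fst_def)
    qed
  qed
  then show ?thesis by (simp add: dual_norm_def)
qed


section \<open>Conjugates\<close>

definition conjugate :: "('a::real_inner \<Rightarrow> real) \<Rightarrow> 'a \<Rightarrow> ereal"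
  where "conjugate f z = (SUP x. ereal (z \<bullet> x - f x))"

text \<open>The expression \<open>t f\<^sup>*(z/t)\<close> for \<open>t \<ge> 0\<close>, with its convention at \<open>t = 0\<close>.\<close>

definition conj_persp :: "('a::real_inner \<Rightarrow> real) \<Rightarrow> real \<Rightarrow> 'a \<Rightarrow> ereal"
  where "conj_persp f t z =
    (if t = 0 then (if z = 0 then 0 else \<infinity>) else ereal t * conjugate f (z /\<^sub>R t))"


section \<open>Wasserstein balls and risk\<close>

definition couplings ::
    "'a::second_countable_topology measure \<Rightarrow> 'a measure \<Rightarrow> ('a \<times> 'a) measure set"
  where "couplings Q1 Q2 =
    {P. prob_space P \<and> sets P = sets borel \<and> distr P borel fst = Q1 \<and> distr P borel snd = Q2}"

definition wasserstein1 ::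
    "('a::euclidean_space \<Rightarrow> real) \<Rightarrow> 'a measure \<Rightarrow> 'a measure \<Rightarrow> ennreal"
  where "wasserstein1 N Q1 Q2 =
    (INF P\<in>couplings Q1 Q2. \<integral>\<^sup>+ p. ennreal (N (fst p - snd p)) \<partial>P)"

definition distributions1 ::
    "('a::euclidean_space \<Rightarrow> real) \<Rightarrow> 'a set \<Rightarrow> 'a measure set"
  where "distributions1 N X =
    {Q. prob_space Q \<and> sets Q = sets borel \<and> (AE \<xi> in Q. \<xi> \<in> X) \<and>
        (\<integral>\<^sup>+ \<xi>. ennreal (N \<xi>) \<partial>Q) < \<infinity>}"

text \<open>The center \<open>P\<close> of the ball need not be supported on \<open>X\<close>.\<close>

definition wasserstein_ball ::
    "('a::euclidean_space \<Rightarrow> real) \<Rightarrow> 'a set \<Rightarrow> real \<Rightarrow> 'a measure \<Rightarrow> 'a measure set"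
  where "wasserstein_ball N X \<epsilon> P =
    {Q \<in> distributions1 N X. wasserstein1 N Q P \<le> ennreal \<epsilon>}"

definition empirical :: "('i::finite \<Rightarrow> 'a::topological_space) \<Rightarrow> 'a measure"
  where "empirical \<xi> = distr (uniform_count_measure UNIV) borel \<xi>"

definition cvar :: "real \<Rightarrow> 'a measure \<Rightarrow> ('a \<Rightarrow> ereal) \<Rightarrow> ereal"
  where "cvar \<alpha> Q l =
    (INF \<tau>::real. ereal \<tau> +
      ereal (1 / \<alpha>) * enn2ereal (\<integral>\<^sup>+ \<xi>. e2ennreal (max (l \<xi> - ereal \<tau>) 0) \<partial>Q))"


section \<open>The inverse optimization problem\<close>

definition responses ::
    "real^'n^'q \<Rightarrow> real^'m^'q \<Rightarrow> real^'q \<Rightarrow> (real^'q) set \<Rightarrow> real^'m \<Rightarrow> (real^'n) set"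
  where "responses W H h K s = {x. W *v x - (H *v s + h) \<in> K}"

definition support_set ::
    "real^'m^'p \<Rightarrow> real^'p \<Rightarrow> (real^'p) set \<Rightarrow>
     real^'n^'q \<Rightarrow> real^'m^'q \<Rightarrow> real^'q \<Rightarrow> (real^'q) set \<Rightarrow> ((real^'m) \<times> (real^'n)) set"
  where "support_set C d CC W H h K =
    {(s, x). C *v s - d \<in> CC \<and> x \<in> responses W H h K s}"

definition has_slater_point ::
    "real^'m^'p \<Rightarrow> real^'p \<Rightarrow> (real^'p) set \<Rightarrow>
     real^'n^'q \<Rightarrow> real^'m^'q \<Rightarrow> real^'q \<Rightarrow> (real^'q) set \<Rightarrow> bool"
  where "has_slater_point C d CC W H h K \<longleftrightarrow>
    (\<exists>s x. C *v s - d \<in> interior CC \<and> W *v x - (H *v s + h) \<in> interior K)"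

text \<open>The minimum is taken as an infimum in the extended reals, so that no attainment or
  boundedness of the forward problem is presupposed.\<close>

definition subopt_loss ::
    "('s \<Rightarrow> 'x \<Rightarrow> real) \<Rightarrow> ('s \<Rightarrow> 'x set) \<Rightarrow> 's \<times> 'x \<Rightarrow> ereal"
  where "subopt_loss F X = (\<lambda>(s, x). ereal (F s x) - (INF y\<in>X s. ereal (F s y)))"

definition hypothesis_fun ::
    "(real^'n \<Rightarrow> real^'D) \<Rightarrow> real^'D \<Rightarrow> real^'m \<Rightarrow> real^'n \<Rightarrow> real"
  where "hypothesis_fun \<Psi> \<theta> s x = \<theta> \<bullet> \<Psi> x"

definition worst_case_risk ::
    "real^'m^'p \<Rightarrow> real^'p \<Rightarrow> (real^'p) set \<Rightarrow>
     real^'n^'q \<Rightarrow> real^'m^'q \<Rightarrow> real^'q \<Rightarrow> (real^'q) set \<Rightarrow>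
     (real^'n \<Rightarrow> real^'D) \<Rightarrow> ((real^'m) \<times> (real^'n) \<Rightarrow> real) \<Rightarrow>
     ('N::finite \<Rightarrow> real^'m) \<Rightarrow> ('N \<Rightarrow> real^'n) \<Rightarrow> real \<Rightarrow> real \<Rightarrow> real^'D \<Rightarrow> ereal"
  where "worst_case_risk C d CC W H h K \<Psi> N shat xhat \<alpha> \<epsilon> \<theta> =
    (SUP Q\<in>wasserstein_ball N (support_set C d CC W H h K) \<epsilon> (empirical (\<lambda>i. (shat i, xhat i))).
       cvar \<alpha> Q (subopt_loss (hypothesis_fun \<Psi> \<theta>) (responses W H h K)))"


section \<open>The convex program\<close>

text \<open>The variables other than \<open>\<theta>\<close>, in the order
  \<open>\<lambda>, \<tau>, r\<^sub>i, \<phi>\<^sub>i\<^sub>1, \<phi>\<^sub>i\<^sub>2, \<gamma>\<^sub>i, z\<^sub>i\<^sub>j\<close>. The sample index ranges over the finite type \<open>'N\<close>, so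
  \<open>N = CARD('N)\<close> and the variables form a vector space.\<close>

type_synonym ('N, 'D, 'p, 'q, 'n) prog_vars =
  "real \<times> real \<times> (real^'N) \<times> (real^'p^'N) \<times> (real^'p^'N) \<times> (real^'q^'N) \<times> (real^'n^'D^'N)"

text \<open>The norm \<open>N\<close> is the one on the signal-feature space whose dual norm occurs in the
  program.\<close>

definition feasible_set ::
    "real^'m^'p \<Rightarrow> real^'p \<Rightarrow> (real^'p) set \<Rightarrow>
     real^'n^'q \<Rightarrow> real^'m^'q \<Rightarrow> real^'q \<Rightarrow> (real^'q) set \<Rightarrow>
     (real^'n \<Rightarrow> real^'D) \<Rightarrow> ((real^'m) \<times> (real^'D) \<Rightarrow> real) \<Rightarrow> (real^'D) set \<Rightarrow>
     ('N::finite \<Rightarrow> real^'m) \<Rightarrow> ('N \<Rightarrow> real^'n) \<Rightarrow>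
     ((real^'D) \<times> ('N, 'D, 'p, 'q, 'n) prog_vars) set"
  where "feasible_set C d CC W H h K \<Psi> N \<Theta> shat xhat =
    {(\<theta>, lam, \<tau>, r, \<phi>1, \<phi>2, \<gamma>, z).
       \<theta> \<in> \<Theta> \<and> 0 \<le> lam \<and>
       (\<forall>i. \<phi>1 $ i \<in> dual_cone CC \<and> \<phi>2 $ i \<in> dual_cone CC \<and> \<gamma> $ i \<in> dual_cone K) \<and>
       (\<forall>i. (\<Sum>j\<in>UNIV. conj_persp (\<lambda>x. \<Psi> x $ j) (\<theta> $ j) (z $ i $ j))
              + ereal (\<theta> \<bullet> \<Psi> (xhat i) + \<phi>1 $ i \<bullet> (C *v shat i - d) - \<gamma> $ i \<bullet> (H *v shat i + h))
            \<le> ereal (r $ i + \<tau>)) \<and>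
       (\<forall>i. (\<Sum>j\<in>UNIV. z $ i $ j) = transpose W *v (\<gamma> $ i)) \<and>
       (\<forall>i. (C *v shat i - d) \<bullet> \<phi>2 $ i \<le> r $ i) \<and>
       (\<forall>i. dual_norm N (transpose H *v (\<gamma> $ i) - transpose C *v (\<phi>1 $ i), \<theta>) \<le> lam) \<and>
       (\<forall>i. dual_norm N (transpose C *v (\<phi>2 $ i), 0) \<le> lam)}"

definition objective ::
    "real \<Rightarrow> real \<Rightarrow> (real^'D) \<times> ('N::finite, 'D, 'p, 'q, 'n) prog_vars \<Rightarrow> real"
  where "objective \<alpha> \<epsilon> = (\<lambda>(\<theta>, lam, \<tau>, r, \<phi>1, \<phi>2, \<gamma>, z).
    \<tau> + 1 / \<alpha> * (\<epsilon> * lam + 1 / real CARD('N) * (\<Sum>i\<in>UNIV. r $ i)))"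

text \<open>The infimum over all variables but \<open>\<theta>\<close>, and \<open>\<infinity>\<close> if no such variables are feasible.\<close>

definition program_value ::
    "((real^'D) \<times> ('N::finite, 'D, 'p, 'q, 'n) prog_vars) set \<Rightarrow> real \<Rightarrow> real \<Rightarrow> real^'D \<Rightarrow> ereal"
  where "program_value A \<alpha> \<epsilon> \<theta> = (INF v\<in>{v. (\<theta>, v) \<in> A}. ereal (objective \<alpha> \<epsilon> (\<theta>, v)))"

text \<open>\<open>risk\<close> is the function of \<open>\<theta>\<close> to be minimized over \<open>\<Theta>\<close>, and \<open>A\<close> the feasible set of
  the program meant to approximate it conservatively.\<close>

definition safe_approximation ::
    "(real^'D) set \<Rightarrow> (real^'D \<Rightarrow> ereal) \<Rightarrow>
     ((real^'D) \<times> ('N::finite, 'D, 'p, 'q, 'n) prog_vars) set \<Rightarrow> real \<Rightarrow> real \<Rightarrow> bool"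
  where "safe_approximation \<Theta> risk A \<alpha> \<epsilon> \<longleftrightarrow> (\<forall>\<theta>\<in>\<Theta>. risk \<theta> \<le> program_value A \<alpha> \<epsilon> \<theta>)"

text \<open>A caveat on signs. The loss bound encoded by the program has the slope
  \<open>(C\<^sup>T\<phi>\<^sub>i\<^sub>1 - H\<^sup>T\<gamma>\<^sub>i, \<theta>)\<close> in \<open>(s, \<Psi>(x))\<close>, whereas the program constrains the dual norm of
  \<open>(H\<^sup>T\<gamma>\<^sub>i - C\<^sup>T\<phi>\<^sub>i\<^sub>1, \<theta>)\<close>. The two dual norms agree if the norm is invariant under
  \<open>s \<mapsto> - s\<close>; for other norms the program need not be safe. One-dimensional example:
  \<open>N (s, x) = 2 * \<bar>s + x\<bar> + \<bar>s - x\<bar> / 2\<close> (for both norms), \<open>\<Psi> = id\<close>, \<open>\<theta> = 1\<close>,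
  \<open>\<alpha> = \<epsilon> = 1\<close>, both cones \<open>{0..}\<close>, \<open>C = 0\<close>, \<open>d = -1\<close>, \<open>W = H = 1\<close>, \<open>h = 0\<close> and the single
  sample \<open>(0, 0)\<close>. The point mass at \<open>(-1, 1)\<close> is in the ball and has loss \<open>2\<close>, while
  \<open>\<gamma> = z = 1\<close>, \<open>\<lambda> = 1/2\<close> and zeros elsewhere are feasible with objective \<open>1/2\<close>.
  By \<open>dual_norm_flip_fst\<close>, the program for \<open>flip_fst N\<close> is the one with
  \<open>C\<^sup>T\<phi>\<^sub>i\<^sub>1 - H\<^sup>T\<gamma>\<^sub>i\<close> and the dual norm of \<open>N\<close>, and the two programs coincide for invariant norms.\<close>

end

theory Submission
  imports Defs
begin

text \<open>Weak duality. If \<open>t\<^sub>j f\<^sub>j\<^sup>*(z\<^sub>j/t\<^sub>j) \<le> c\<^sub>j\<close> and \<open>\<Sum>z\<^sub>j = W\<^sup>T\<gamma>\<close>, then Fenchel's inequality bounds the optimal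
  value of the forward problem at \<open>s\<close> from below by \<open>\<gamma> \<bullet> (H s + h) - \<Sum>c\<^sub>j\<close>. Adding the nonnegative
  \<open>\<phi>\<^sub>1 \<bullet> (C s - d)\<close> yields a majorant of the loss on the support that is affine in \<open>(s, \<Psi> x)\<close>, so by
  the Lipschitz condition on \<open>\<Psi>\<close> the positive part of \<open>loss - \<tau>\<close> is at most
  \<open>\<lambda> N(\<xi> - \<xi>\<^sub>i) + r\<^sub>i\<close> for every sample \<open>\<xi>\<^sub>i\<close>. Integrating this against nearly optimal couplings
  gives the bound on the risk. The program is convex because the perspective of a conjugate
  is a supremum of linear functions.\<close>

section \<open>Arbitrary norms on Euclidean spaces and their dual norms\<close>

lemma is_norm_zero: "is_norm N \<Longrightarrow> N 0 = 0"
  by (simp add: is_norm_def)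

lemma is_norm_scaleR: "is_norm N \<Longrightarrow> N (c *\<^sub>R v) = \<bar>c\<bar> * N v"
  by (simp add: is_norm_def)

lemma is_norm_triangle: "is_norm N \<Longrightarrow> N (v + w) \<le> N v + N w"
  by (simp add: is_norm_def)

lemma is_norm_minus: "is_norm N \<Longrightarrow> N (- v) = N v"
  using is_norm_scaleR[of N "-1" v] by simp

lemma is_norm_nonneg:
  assumes "is_norm N"
  shows "0 \<le> N v"
  using is_norm_triangle[OF assms, of v "- v"] is_norm_minus[OF assms, of v] is_norm_zero[OF assms]
  by simp

lemma is_norm_pos: "is_norm N \<Longrightarrow> v \<noteq> 0 \<Longrightarrow> 0 < N v"
  by (metis is_norm_def is_norm_nonneg less_eq_real_def)

text \<open>The triangle inequality and homogeneity make a norm convex, and a finite convex function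
  on a finite-dimensional space is continuous.\<close>

lemma is_norm_continuous_on:
  fixes N :: "'a::euclidean_space \<Rightarrow> real"
  assumes "is_norm N"
  shows "continuous_on UNIV N"
proof (rule convex_on_continuous)
  show "convex_on UNIV N"
  proof (intro convex_onI)
    fix t :: real and x y :: 'a
    assume "0 < t" "t < 1"
    then show "N ((1 - t) *\<^sub>R x + t *\<^sub>R y) \<le> (1 - t) * N x + t * N y"
      using is_norm_triangle[OF assms, of "(1 - t) *\<^sub>R x" "t *\<^sub>R y"]
      by (simp add: is_norm_scaleR[OF assms])
  qed simp
qed simp

text \<open>By compactness \<open>N\<close> attains a minimum on the Euclidean unit sphere, and this
  minimum is positive. It bounds the unit ball of \<open>N\<close>, so that the supremum in
  \<open>dual_norm\<close> is that of a bounded set.\<close>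

lemma is_norm_lower_bound:
  fixes N :: "'a::euclidean_space \<Rightarrow> real"
  assumes "is_norm N"
  obtains c where "0 < c" "\<And>v. c * norm v \<le> N v"
proof -
  have "sphere (0::'a) 1 \<noteq> {}" by simp
  then obtain w :: 'a where w: "w \<in> sphere 0 1" "\<And>v. v \<in> sphere 0 1 \<Longrightarrow> N w \<le> N v"
    using continuous_attains_inf[OF compact_sphere, of 0 1 N]
      continuous_on_subset[OF is_norm_continuous_on[OF assms]] by blast
  show thesis
  proof
    show "0 < N w" using w(1) by (intro is_norm_pos[OF assms]) auto
    show "N w * norm v \<le> N v" for v
    proof (cases "v = 0")
      case False
      then have "N w \<le> N (v /\<^sub>R norm v)" by (intro w(2)) simp
      also have "\<dots> = N v / norm v" by (simp add: is_norm_scaleR[OF assms] divide_inverse)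
      finally show ?thesis using False by (simp add: field_simps)
    qed (simp add: is_norm_zero[OF assms])
  qed
qed

text \<open>Rescaling a nonzero \<open>s\<close> to \<open>N\<close>-length one turns the bound on
  the unit ball into a homogeneous inequality. In this form a dual norm constraint is a family of
  linear inequalities in \<open>(t, l)\<close>, which serves both the convexity of the program and
  the slope estimate for the loss.\<close>

lemma dual_norm_le_iff:
  fixes N :: "'a::euclidean_space \<Rightarrow> real"
  assumes "is_norm N"
  shows "dual_norm N t \<le> l \<longleftrightarrow> (\<forall>s. t \<bullet> s \<le> l * N s)"
proof -
  obtain c where c: "0 < c" "\<And>v. c * norm v \<le> N v"
    using is_norm_lower_bound[OF assms] by blast
  have "bdd_above ((\<lambda>s. t \<bullet> s) ` {s. N s \<le> 1})"
  proof (rule bdd_aboveI2)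
    fix s assume "s \<in> {s. N s \<le> 1}"
    then have "norm s \<le> 1 / c" using c(2)[of s] c(1) by (simp add: field_simps)
    then have "norm t * norm s \<le> norm t * (1 / c)" by (intro mult_left_mono) auto
    then show "t \<bullet> s \<le> norm t * (1 / c)" using norm_cauchy_schwarz[of t s] by linarith
  qed
  moreover have "{s. N s \<le> 1} \<noteq> {}" using is_norm_zero[OF assms] by (intro ex_in_conv[THEN iffD1] exI[of _ 0]) simp
  ultimately have "dual_norm N t \<le> l \<longleftrightarrow> (\<forall>s\<in>{s. N s \<le> 1}. t \<bullet> s \<le> l)"
    unfolding dual_norm_def by (subst cSUP_le_iff) auto
  also have "\<dots> \<longleftrightarrow> (\<forall>s. t \<bullet> s \<le> l * N s)"
  proof (intro iffI allI ballI)
    fix s assume *: "\<forall>s\<in>{s. N s \<le> 1}. t \<bullet> s \<le> l"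
    show "t \<bullet> s \<le> l * N s"
    proof (cases "s = 0")
      case False
      then have "0 < N s" by (rule is_norm_pos[OF assms])
      moreover have "t \<bullet> (s /\<^sub>R N s) \<le> l"
        using *[rule_format, of "s /\<^sub>R N s"] \<open>0 < N s\<close> by (simp add: is_norm_scaleR[OF assms])
      ultimately show ?thesis by (simp add: field_simps)
    qed (simp add: is_norm_zero[OF assms])
  next
    fix s assume *: "\<forall>s. t \<bullet> s \<le> l * N s" and s: "s \<in> {s. N s \<le> 1}"
    \<comment> \<open>Passing from \<open>l * N s\<close> to \<open>l\<close> when
      \<open>N s \<le> 1\<close> requires a nonnegative \<open>l\<close>; adding the inequalities at
      \<open>b\<close> and \<open>- b\<close> gives it.\<close>
    have l: "0 \<le> l"
    proof -
      obtain b :: 'a where "b \<in> Basis" using nonempty_Basis by blast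
      then have "0 < N b" using nonzero_Basis by (intro is_norm_pos[OF assms]) auto
      moreover have "0 \<le> l * N b + l * N b"
        using *[rule_format, of b] *[rule_format, of "- b"] by (simp add: is_norm_minus[OF assms])
      ultimately show ?thesis by (simp add: zero_le_mult_iff)
    qed
    show "t \<bullet> s \<le> l"
      using *[rule_format, of s] mult_left_mono[of "N s" 1 l] s l by simp
  qed
  finally show ?thesis .
qed

text \<open>The unit ball of \<open>N\<close> is symmetric. This removes the sign from the
  \<open>\<phi>2\<close> constraint of the flipped program, whose feature part is zero.\<close>

lemma dual_norm_minus:
  fixes N :: "'a::euclidean_space \<Rightarrow> real"
  assumes "is_norm N"
  shows "dual_norm N (- t) = dual_norm N t"
proof -
  have "dual_norm N (- t) \<le> l" if "dual_norm N t \<le> l" for t l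
    unfolding dual_norm_le_iff[OF assms]
  proof
    fix s
    show "- t \<bullet> s \<le> l * N s"
      using that[unfolded dual_norm_le_iff[OF assms], rule_format, of "- s"]
      by (simp add: is_norm_minus[OF assms])
  qed
  from this[of t] this[of "- t"] show ?thesis by (simp add: order_antisym)
qed

lemma is_norm_flip_fst:
  fixes N :: "'a::real_vector \<times> 'b::real_vector \<Rightarrow> real"
  assumes "is_norm N"
  shows "is_norm (flip_fst N)"
  unfolding is_norm_def flip_fst_def
proof (intro conjI allI)
  fix v w :: "'a \<times> 'b" and c :: real
  show "((case v of (u, v) \<Rightarrow> N (- u, v)) = 0) = (v = 0)"
    using assms by (cases v) (auto simp: is_norm_def zero_prod_def)
  show "(case c *\<^sub>R v of (u, v) \<Rightarrow> N (- u, v)) = \<bar>c\<bar> * (case v of (u, v) \<Rightarrow> N (- u, v))"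
    using is_norm_scaleR[OF assms, of c "(- fst v, snd v)"] by (cases v) simp
  show "(case v + w of (u, v) \<Rightarrow> N (- u, v))
      \<le> (case v of (u, v) \<Rightarrow> N (- u, v)) + (case w of (u, v) \<Rightarrow> N (- u, v))"
    using is_norm_triangle[OF assms, of "(- fst v, snd v)" "(- fst w, snd w)"]
    by (cases v; cases w) simp
qed

section \<open>Dual cones and perspectives of conjugates\<close>

lemma convex_dual_cone: "convex (dual_cone K)"
  unfolding convex_def dual_cone_def by (auto simp: inner_add_left)

text \<open>For \<open>t \<ge> 0\<close> the perspective of the conjugate is the supremum of \<open>z \<bullet> x - t f x\<close> over \<open>x\<close>,
  and these expressions are linear in \<open>(t, z)\<close>.\<close>

lemma conj_persp_le_iff:
  assumes "0 \<le> t"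
  shows "conj_persp f t z \<le> ereal c \<longleftrightarrow> (\<forall>x. z \<bullet> x - t * f x \<le> c)"
proof (cases "t = 0")
  case True
  show ?thesis
  proof (cases "z = 0")
    case False
    \<comment> \<open>The multiple of \<open>z\<close> is scaled so that the inner product equals
      \<open>\<bar>c\<bar> + 1\<close>, which exceeds \<open>c\<close>.\<close>
    have "\<not> z \<bullet> (((\<bar>c\<bar> + 1) / (z \<bullet> z)) *\<^sub>R z) \<le> c"
      using False by simp
    then have "\<not> (\<forall>x. z \<bullet> x \<le> c)" by blast
    then show ?thesis using True False by (simp add: conj_persp_def)
  qed (simp add: conj_persp_def True)
next
  case False
  then have t: "0 < t" using assms by simp
  have "conj_persp f t z \<le> ereal c \<longleftrightarrow> conjugate f (z /\<^sub>R t) \<le> ereal c / ereal t"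
    using t by (simp add: conj_persp_def ereal_le_divide_pos del: ereal_divide)
  also have "\<dots> \<longleftrightarrow> (\<forall>x. (z /\<^sub>R t) \<bullet> x - f x \<le> c / t)"
    using t by (simp add: conjugate_def SUP_le_iff)
  also have "\<dots> \<longleftrightarrow> (\<forall>x. z \<bullet> x - t * f x \<le> c)"
  proof (rule all_cong1)
    fix x
    have "(z /\<^sub>R t) \<bullet> x - f x = (z \<bullet> x - t * f x) / t" using t by (simp add: field_simps)
    then show "(z /\<^sub>R t) \<bullet> x - f x \<le> c / t \<longleftrightarrow> z \<bullet> x - t * f x \<le> c"
      using t by (simp add: divide_le_cancel)
  qed
  finally show ?thesis .
qed

lemma conj_persp_neq_MInf:
  assumes "0 \<le> t"
  shows "conj_persp f t z \<noteq> -\<infinity>"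
proof
  assume *: "conj_persp f t z = -\<infinity>"
  \<comment> \<open>The value minus infinity lies below every real; the bound chosen here fails at
    \<open>x = 0\<close> by exactly one.\<close>
  have "\<forall>x. z \<bullet> x - t * f x \<le> - t * f 0 - 1"
    using conj_persp_le_iff[OF assms, of f z "- t * f 0 - 1"] * by simp
  from this[rule_format, of 0] show False by simp
qed

text \<open>Since no summand is minus infinity, a finite upper bound on the sum forces every summand
  to be real, and these reals serve as the \<open>c j\<close>. The extended-real constraint thereby
  becomes a system of real inequalities linear in \<open>t\<close>, \<open>z\<close>,
  \<open>c\<close>, \<open>a\<close> and \<open>b\<close>, used for convexity as well as for weak
  duality.\<close>

lemma sum_conj_persp_le_iff:
  fixes t :: "'j::finite \<Rightarrow> real"
  assumes "\<And>j. 0 \<le> t j"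
  shows "(\<Sum>j\<in>UNIV. conj_persp (f j) (t j) (z j)) + ereal a \<le> ereal b \<longleftrightarrow>
    (\<exists>c. (\<forall>j x. z j \<bullet> x - t j * f j x \<le> c j) \<and> (\<Sum>j\<in>UNIV. c j) + a \<le> b)"
    (is "?L \<longleftrightarrow> ?R")
proof
  assume L: ?L
  then have "(\<Sum>j\<in>UNIV. conj_persp (f j) (t j) (z j)) \<noteq> \<infinity>" by auto
  then have "conj_persp (f j) (t j) (z j) \<noteq> \<infinity>" for j
    by (simp add: sum_Pinfty)
  then have c: "ereal (real_of_ereal (conj_persp (f j) (t j) (z j))) = conj_persp (f j) (t j) (z j)" for j
    using conj_persp_neq_MInf[OF assms[of j], of "f j" "z j"]
    by (intro ereal_real') auto
  show ?R
  proof (intro exI[of _ "\<lambda>j. real_of_ereal (conj_persp (f j) (t j) (z j))"] conjI allI)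
    show "z j \<bullet> x - t j * f j x \<le> real_of_ereal (conj_persp (f j) (t j) (z j))" for j x
      using conj_persp_le_iff[OF assms[of j], of "f j" "z j"] c[of j] by (metis order_refl)
    have "ereal ((\<Sum>j\<in>UNIV. real_of_ereal (conj_persp (f j) (t j) (z j))) + a) \<le> ereal b"
      using L by (simp add: c flip: plus_ereal.simps(1) sum_ereal)
    then show "(\<Sum>j\<in>UNIV. real_of_ereal (conj_persp (f j) (t j) (z j))) + a \<le> b" by simp
  qed
next
  assume ?R
  then obtain c where c: "\<And>j x. z j \<bullet> x - t j * f j x \<le> c j" "(\<Sum>j\<in>UNIV. c j) + a \<le> b"
    by blast
  have "(\<Sum>j\<in>UNIV. conj_persp (f j) (t j) (z j)) \<le> (\<Sum>j\<in>UNIV. ereal (c j))"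
    using c(1) by (intro sum_mono) (simp add: conj_persp_le_iff[OF assms])
  then have "(\<Sum>j\<in>UNIV. conj_persp (f j) (t j) (z j)) + ereal a \<le> ereal ((\<Sum>j\<in>UNIV. c j) + a)"
    by (auto intro: add_right_mono simp flip: plus_ereal.simps(1))
  also have "\<dots> \<le> ereal b" using c(2) by simp
  finally show ?L .
qed

section \<open>Convexity of the program\<close>

lemma convex_combination_le:
  fixes u v :: real
  assumes "a \<le> b" "c \<le> d" "0 \<le> u" "0 \<le> v"
  shows "u * a + v * c \<le> u * b + v * d"
  using assms by (intro add_mono mult_left_mono)

text \<open>With the auxiliary bounds \<open>c\<close> from \<open>sum_conj_persp_le_iff\<close> and
  the pointwise form of the dual norm, the constraints other than membership in
  \<open>\<Theta>\<close> and in the dual cones are linear, and those sets are convex.\<close>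

lemma convex_feasible_set:
  fixes \<Psi> :: "real^'n \<Rightarrow> real^'D" and shat :: "'N::finite \<Rightarrow> real^'m"
  assumes N: "is_norm N" and \<Theta>: "convex \<Theta>" "\<Theta> \<subseteq> {\<theta>. \<forall>j. 0 \<le> \<theta> $ j}"
  shows "convex (feasible_set C d CC W H h K \<Psi> N \<Theta> shat xhat)"
proof (rule convexI, goal_cases)
  case (1 p p' u v)
  obtain \<theta> lam \<tau> r \<phi>1 \<phi>2 \<gamma> z where p: "p = (\<theta>, lam, \<tau>, r, \<phi>1, \<phi>2, \<gamma>, z)" by (cases p) auto
  obtain \<theta>' lam' \<tau>' r' \<phi>1' \<phi>2' \<gamma>' z' where p': "p' = (\<theta>', lam', \<tau>', r', \<phi>1', \<phi>2', \<gamma>', z')"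
    by (cases p') auto
  note uv = \<open>0 \<le> u\<close> \<open>0 \<le> v\<close>
  note mem = \<open>p \<in> _\<close>[unfolded p feasible_set_def mem_Collect_eq prod.case]
  note mem' = \<open>p' \<in> _\<close>[unfolded p' feasible_set_def mem_Collect_eq prod.case]
  have \<theta>: "u *\<^sub>R \<theta> + v *\<^sub>R \<theta>' \<in> \<Theta>"
    using mem mem' 1 by (intro convexD[OF \<Theta>(1)]) auto
  have dual: "dual_norm N (u *\<^sub>R a + v *\<^sub>R b) \<le> u * l + v * l'"
    if "dual_norm N a \<le> l" "dual_norm N b \<le> l'" for a b l l'
    unfolding dual_norm_le_iff[OF N]
  proof
    fix s
    have "u * (a \<bullet> s) + v * (b \<bullet> s) \<le> u * (l * N s) + v * (l' * N s)"
      using that[unfolded dual_norm_le_iff[OF N]] uv by (intro convex_combination_le) blast+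
    then show "(u *\<^sub>R a + v *\<^sub>R b) \<bullet> s \<le> (u * l + v * l') * N s"
      by (simp add: inner_add_left algebra_simps)
  qed
  have "(\<Sum>j\<in>UNIV. conj_persp (\<lambda>x. \<Psi> x $ j) ((u *\<^sub>R \<theta> + v *\<^sub>R \<theta>') $ j) ((u *\<^sub>R z + v *\<^sub>R z') $ i $ j))
      + ereal ((u *\<^sub>R \<theta> + v *\<^sub>R \<theta>') \<bullet> \<Psi> (xhat i) + (u *\<^sub>R \<phi>1 + v *\<^sub>R \<phi>1') $ i \<bullet> (C *v shat i - d)
          - (u *\<^sub>R \<gamma> + v *\<^sub>R \<gamma>') $ i \<bullet> (H *v shat i + h))
      \<le> ereal ((u *\<^sub>R r + v *\<^sub>R r') $ i + (u * \<tau> + v * \<tau>'))" for i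
  proof -
    let ?a = "\<theta> \<bullet> \<Psi> (xhat i) + \<phi>1 $ i \<bullet> (C *v shat i - d) - \<gamma> $ i \<bullet> (H *v shat i + h)"
    let ?a' = "\<theta>' \<bullet> \<Psi> (xhat i) + \<phi>1' $ i \<bullet> (C *v shat i - d) - \<gamma>' $ i \<bullet> (H *v shat i + h)"
    have nonneg: "0 \<le> \<theta> $ j" "0 \<le> \<theta>' $ j" for j using mem mem' \<Theta>(2) by blast+
    obtain c where c: "\<And>j x. z $ i $ j \<bullet> x - \<theta> $ j * \<Psi> x $ j \<le> c j"
        "(\<Sum>j\<in>UNIV. c j) + ?a \<le> r $ i + \<tau>"
      using iffD1[OF sum_conj_persp_le_iff[where t = "($) \<theta>" and z = "($) (z $ i)"
            and f = "\<lambda>j x. \<Psi> x $ j", OF nonneg(1)], of ?a "r $ i + \<tau>"] mem by blast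
    obtain c' where c': "\<And>j x. z' $ i $ j \<bullet> x - \<theta>' $ j * \<Psi> x $ j \<le> c' j"
        "(\<Sum>j\<in>UNIV. c' j) + ?a' \<le> r' $ i + \<tau>'"
      using iffD1[OF sum_conj_persp_le_iff[where t = "($) \<theta>'" and z = "($) (z' $ i)"
            and f = "\<lambda>j x. \<Psi> x $ j", OF nonneg(2)], of ?a' "r' $ i + \<tau>'"] mem' by blast
    \<comment> \<open>The equivalence is now used backwards at the combined point, whose weights
      must be nonnegative; the bounds \<open>c\<close> and \<open>c'\<close> combine with the same
      coefficients as the variables.\<close>
    have "\<And>j. 0 \<le> (u *\<^sub>R \<theta> + v *\<^sub>R \<theta>') $ j" using \<theta> \<Theta>(2) by blast
    then show ?thesis
    proof (subst sum_conj_persp_le_iff, assumption, intro exI[of _ "\<lambda>j. u * c j + v * c' j"] conjI allI)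
      fix j x
      show "(u *\<^sub>R z + v *\<^sub>R z') $ i $ j \<bullet> x - (u *\<^sub>R \<theta> + v *\<^sub>R \<theta>') $ j * \<Psi> x $ j \<le> u * c j + v * c' j"
        using convex_combination_le[OF c(1) c'(1) uv, of j x j x]
        by (simp add: inner_add_left algebra_simps)
    next
      show "(\<Sum>j\<in>UNIV. u * c j + v * c' j) + ((u *\<^sub>R \<theta> + v *\<^sub>R \<theta>') \<bullet> \<Psi> (xhat i)
          + (u *\<^sub>R \<phi>1 + v *\<^sub>R \<phi>1') $ i \<bullet> (C *v shat i - d) - (u *\<^sub>R \<gamma> + v *\<^sub>R \<gamma>') $ i \<bullet> (H *v shat i + h))
          \<le> (u *\<^sub>R r + v *\<^sub>R r') $ i + (u * \<tau> + v * \<tau>')"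
        using convex_combination_le[OF c(2) c'(2) uv]
        by (simp add: inner_add_left sum.distrib distrib_left right_diff_distrib flip: sum_distrib_left)
    qed
  qed
  moreover have "dual_norm N (transpose H *v ((u *\<^sub>R \<gamma> + v *\<^sub>R \<gamma>') $ i)
      - transpose C *v ((u *\<^sub>R \<phi>1 + v *\<^sub>R \<phi>1') $ i), u *\<^sub>R \<theta> + v *\<^sub>R \<theta>') \<le> u * lam + v * lam'" for i
  proof -
    have "dual_norm N (transpose H *v (\<gamma> $ i) - transpose C *v (\<phi>1 $ i), \<theta>) \<le> lam"
      "dual_norm N (transpose H *v (\<gamma>' $ i) - transpose C *v (\<phi>1' $ i), \<theta>') \<le> lam'"
      using mem mem' by auto
    from dual[OF this] show ?thesis
      by (simp add: matrix_vector_right_distrib matrix_vector_mult_scaleR algebra_simps)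
  qed
  moreover have "dual_norm N (transpose C *v ((u *\<^sub>R \<phi>2 + v *\<^sub>R \<phi>2') $ i), 0)
      \<le> u * lam + v * lam'" for i
  proof -
    have "dual_norm N (transpose C *v (\<phi>2 $ i), 0) \<le> lam"
      "dual_norm N (transpose C *v (\<phi>2' $ i), 0) \<le> lam'"
      using mem mem' by auto
    from dual[OF this] show ?thesis
      by (simp add: matrix_vector_right_distrib matrix_vector_mult_scaleR)
  qed
  moreover have "(C *v shat i - d) \<bullet> ((u *\<^sub>R \<phi>2 + v *\<^sub>R \<phi>2') $ i) \<le> (u *\<^sub>R r + v *\<^sub>R r') $ i" for i
    using mem mem' uv convex_combination_le[of "(C *v shat i - d) \<bullet> \<phi>2 $ i" "r $ i"
        "(C *v shat i - d) \<bullet> \<phi>2' $ i" "r' $ i" u v]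
    by (simp add: inner_add_right)
  moreover have "(\<Sum>j\<in>UNIV. (u *\<^sub>R z + v *\<^sub>R z') $ i $ j) = transpose W *v ((u *\<^sub>R \<gamma> + v *\<^sub>R \<gamma>') $ i)" for i
    using mem mem'
    by (simp add: sum.distrib matrix_vector_right_distrib matrix_vector_mult_scaleR
        flip: scaleR_sum_right)
  moreover have "(u *\<^sub>R \<phi>1 + v *\<^sub>R \<phi>1') $ i \<in> dual_cone CC" "(u *\<^sub>R \<phi>2 + v *\<^sub>R \<phi>2') $ i \<in> dual_cone CC"
    "(u *\<^sub>R \<gamma> + v *\<^sub>R \<gamma>') $ i \<in> dual_cone K" for i
    using mem mem' 1 by (auto intro!: convexD[OF convex_dual_cone])
  moreover have "0 \<le> u * lam + v * lam'" using mem mem' uv by auto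
  ultimately show ?case
    using \<theta> unfolding p p' feasible_set_def by simp
qed

text \<open>The objective is linear in the variables, so the convexity inequality is proved as an
  equation via \<open>eq_refl\<close>.\<close>

lemma convex_on_objective:
  assumes "convex A"
  shows "convex_on A (objective \<alpha> \<epsilon>)"
  unfolding convex_on_def
proof (intro conjI assms ballI allI impI eq_refl)
  fix p p' u v
  assume "u + v = (1::real)"
  show "objective \<alpha> \<epsilon> (u *\<^sub>R p + v *\<^sub>R p') = u * objective \<alpha> \<epsilon> p + v * objective \<alpha> \<epsilon> p'"
    by (cases p; cases p') (simp add: objective_def sum.distrib algebra_simps add_divide_distrib flip: sum_distrib_left)
qed

section \<open>Integration against couplings with the empirical distribution, and CVaR\<close>

lemma measurable_finite_modification_const:
  fixes g :: "'a::t1_space \<Rightarrow> real"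
  assumes "finite X" "\<And>x. x \<notin> X \<Longrightarrow> g x = c"
  shows "g \<in> borel_measurable borel"
  using assms
  by (intro measurable_discrete_difference[of "\<lambda>_. c" borel borel X g]) (auto simp: countable_finite)

lemma measurable_empirical_sample:
  "\<xi> \<in> measurable (uniform_count_measure (UNIV :: 'i::finite set)) borel"
  by (rule measurableI) (auto simp: space_uniform_count_measure)

lemma prob_space_uniform_count_UNIV:
  "prob_space (uniform_count_measure (UNIV :: 'i::finite set))"
  by (intro prob_space_uniform_count_measure) auto

text \<open>The pointwise bound holds for every sample, so under a coupling it may be used at the
  sample that the second coordinate hits. The transport cost then contributes
  \<open>lam * e\<close>, and the second marginal contributes the average of \<open>r\<close>. The
  claim \<open>0 \<le> b\<close> is stated separately because \<open>ennreal\<close> truncates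
  negative numbers to zero.\<close>

lemma coupling_empirical_bound:
  fixes N :: "'a::euclidean_space \<Rightarrow> real" and \<xi> :: "'i::finite \<Rightarrow> 'a" and r :: "'i \<Rightarrow> real"
    and g :: "'a \<Rightarrow> ennreal"
  assumes N: "is_norm N" and lam: "0 \<le> lam" and e: "0 \<le> e"
    and P: "P \<in> couplings Q (empirical \<xi>)"
    and cost: "(\<integral>\<^sup>+ p. ennreal (N (fst p - snd p)) \<partial>P) \<le> ennreal e"
    and bound: "AE \<zeta> in Q. \<forall>i. 0 \<le> lam * N (\<zeta> - \<xi> i) + r i \<and> g \<zeta> \<le> ennreal (lam * N (\<zeta> - \<xi> i) + r i)"
  defines "b \<equiv> lam * e + (\<Sum>i\<in>UNIV. r i) / real CARD('i)"
  shows "0 \<le> b" and "(\<integral>\<^sup>+ \<zeta>. g \<zeta> \<partial>Q) \<le> ennreal b"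
proof -
  interpret P: prob_space P using P by (simp add: couplings_def)
  interpret U: prob_space "uniform_count_measure (UNIV :: 'i set)"
    by (rule prob_space_uniform_count_UNIV)
  have sets_P [measurable_cong]: "sets P = sets borel" and Q: "distr P borel fst = Q"
    and E: "distr P borel snd = empirical \<xi>"
    using P by (auto simp: couplings_def)
  have fst_P [measurable]: "fst \<in> measurable P borel" and snd_P [measurable]: "snd \<in> measurable P borel"
    unfolding measurable_cong_sets[OF sets_P refl]
    by (intro borel_measurable_continuous_onI continuous_intros)+
  have N_cont: "continuous_on A N" for A
    using is_norm_continuous_on[OF N] continuous_on_subset by blast
  have N_meas [measurable]: "N \<in> borel_measurable borel"
    by (intro borel_measurable_continuous_onI N_cont)
  have cost_meas [measurable]: "(\<lambda>p. N (fst p - snd p)) \<in> borel_measurable P"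
    by measurable
  \<comment> \<open>Samples may coincide, so \<open>r\<close> need not be a function of the sample point; the smallest
    value at each point is one.\<close>
  define \<rho> where "\<rho> \<zeta> = Min (r ` {i. \<xi> i = \<zeta>})" for \<zeta>
  have \<rho>_meas [measurable]: "\<rho> \<in> borel_measurable borel"
  proof (rule measurable_finite_modification_const)
    show "finite (range \<xi>)" by simp
    \<comment> \<open>\<open>Min {}\<close> is an unspecified real, but the same one at every point
      off the samples, so \<open>\<rho>\<close> is constant there.\<close>
    show "\<rho> \<zeta> = Min {}" if "\<zeta> \<notin> range \<xi>" for \<zeta>
      using that by (auto simp: \<rho>_def intro!: arg_cong[of _ _ Min])
  qed
  have \<rho>_le: "\<rho> (\<xi> i) \<le> r i" for i
    unfolding \<rho>_def by (intro Min_le) auto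
  have \<rho>_attained: "\<exists>i. \<xi> i = \<zeta> \<and> \<rho> \<zeta> = r i" if "\<zeta> \<in> range \<xi>" for \<zeta>
  proof -
    have "\<rho> \<zeta> \<in> r ` {i. \<xi> i = \<zeta>}"
      unfolding \<rho>_def using that by (intro Min_in) auto
    then show ?thesis by auto
  qed
  have int_E: "integrable (empirical \<xi>) \<rho>"
    unfolding empirical_def
  proof (subst integrable_distr_eq[OF measurable_empirical_sample \<rho>_meas], rule U.integrable_const_bound)
    show "AE i in uniform_count_measure UNIV. norm (\<rho> (\<xi> i)) \<le> Max (range (\<lambda>i. \<bar>\<rho> (\<xi> i)\<bar>))"
      by (intro AE_I2) (auto intro!: Max_ge)
    show "(\<lambda>i. \<rho> (\<xi> i)) \<in> borel_measurable (uniform_count_measure UNIV)"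
      by (rule measurable_compose[OF measurable_empirical_sample \<rho>_meas])
  qed
  have int_\<rho>: "integrable P (\<lambda>p. \<rho> (snd p))"
    using int_E unfolding E[symmetric] by (rule integrable_distr[OF snd_P])
  have int_N: "integrable P (\<lambda>p. N (fst p - snd p))"
    using cost by (intro integrableI_nonneg) (auto simp: is_norm_nonneg[OF N] less_top[symmetric] top_unique)
  \<comment> \<open>Only the second marginal enters, so the integral is an average over the samples
    whatever the coupling.\<close>
  have "(\<integral>p. \<rho> (snd p) \<partial>P) = (\<integral>\<zeta>. \<rho> \<zeta> \<partial>empirical \<xi>)"
    unfolding E[symmetric] by (simp add: integral_distr)
  also have "\<dots> = (\<Sum>i\<in>UNIV. \<rho> (\<xi> i)) / real CARD('i)"
    unfolding empirical_def
    by (simp add: integral_distr[OF measurable_empirical_sample] integral_uniform_count_measure)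
  also have "\<dots> \<le> (\<Sum>i\<in>UNIV. r i) / real CARD('i)"
    by (intro divide_right_mono sum_mono \<rho>_le) auto
  finally have \<rho>_int_le: "(\<integral>p. \<rho> (snd p) \<partial>P) \<le> (\<Sum>i\<in>UNIV. r i) / real CARD('i)" .
  have "ennreal (\<integral>p. N (fst p - snd p) \<partial>P) \<le> ennreal e"
    using cost nn_integral_eq_integral[OF int_N] by (simp add: is_norm_nonneg[OF N])
  then have "(\<integral>p. N (fst p - snd p) \<partial>P) \<le> e" using e by simp
  from mult_left_mono[OF this lam]
  have le_b: "(\<integral>p. lam * N (fst p - snd p) + \<rho> (snd p) \<partial>P) \<le> b"
    using \<rho>_int_le int_N int_\<rho> by (simp add: b_def)
  have "AE \<zeta> in empirical \<xi>. \<zeta> \<in> range \<xi>"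
    unfolding empirical_def by (subst AE_distr_iff[OF measurable_empirical_sample]) (auto intro!: borel_closed finite_imp_closed)
  then have AE_snd: "AE p in P. snd p \<in> range \<xi>"
    unfolding E[symmetric] by (rule AE_distrD[OF snd_P])
  \<comment> \<open>No measurability is assumed of \<open>g\<close>. The finite infimum
    \<open>G\<close> is a measurable majorant, so its integral over \<open>Q\<close> can be
    transported to the coupling.\<close>
  define G where "G \<zeta> = (INF i. ennreal (lam * N (\<zeta> - \<xi> i) + r i))" for \<zeta>
  have G_meas [measurable]: "G \<in> borel_measurable borel"
    unfolding G_def by measurable
  have AE_fst: "AE p in P. \<forall>i. 0 \<le> lam * N (fst p - \<xi> i) + r i"
    using bound unfolding Q[symmetric] by (rule AE_distrD[OF fst_P, THEN AE_mp]) auto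
  have nonneg: "AE p in P. 0 \<le> lam * N (fst p - snd p) + \<rho> (snd p)"
    using AE_fst AE_snd by eventually_elim (metis \<rho>_attained)
  then show "0 \<le> b"
    using integral_nonneg_AE[OF nonneg] le_b by linarith
  have "(\<integral>\<^sup>+ \<zeta>. g \<zeta> \<partial>Q) \<le> (\<integral>\<^sup>+ \<zeta>. G \<zeta> \<partial>Q)"
    using bound by (intro nn_integral_mono_AE, eventually_elim) (auto simp: G_def intro!: INF_greatest)
  also have "\<dots> = (\<integral>\<^sup>+ p. G (fst p) \<partial>P)"
    unfolding Q[symmetric] by (simp add: nn_integral_distr)
  \<comment> \<open>The infimum \<open>G (fst p)\<close> is at most its member at an index
    \<open>i\<close> with \<open>\<xi> i = snd p\<close> where \<open>\<rho>\<close> attains its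
    value.\<close>
  also have "\<dots> \<le> (\<integral>\<^sup>+ p. ennreal (lam * N (fst p - snd p) + \<rho> (snd p)) \<partial>P)"
  proof (intro nn_integral_mono_AE, use AE_snd in eventually_elim)
    fix p :: "'a \<times> 'a" assume "snd p \<in> range \<xi>"
    then obtain i where "\<xi> i = snd p" "\<rho> (snd p) = r i" using \<rho>_attained by blast
    then show "G (fst p) \<le> ennreal (lam * N (fst p - snd p) + \<rho> (snd p))"
      unfolding G_def by (intro INF_lower2[of i]) auto
  qed
  also have "\<dots> = ennreal (\<integral>p. lam * N (fst p - snd p) + \<rho> (snd p) \<partial>P)"
    using nonneg int_N int_\<rho> by (intro nn_integral_eq_integral) auto
  also have "\<dots> \<le> ennreal b" using le_b by (rule ennreal_leI)
  finally show "(\<integral>\<^sup>+ \<zeta>. g \<zeta> \<partial>Q) \<le> ennreal b" .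
qed

text \<open>The two bounds say that the positive part of \<open>l - \<tau>\<close> is at most
  \<open>lam * N (\<zeta> - \<xi> i) + r i\<close> on the support. A coupling of cost slightly above
  the radius suffices, and the excess vanishes in the limit.\<close>

lemma cvar_le_wasserstein_ball:
  fixes N :: "'a::euclidean_space \<Rightarrow> real" and \<xi> :: "'i::finite \<Rightarrow> 'a" and r :: "'i \<Rightarrow> real"
    and l :: "'a \<Rightarrow> ereal"
  assumes N: "is_norm N" and lam: "0 \<le> lam" and \<epsilon>: "0 \<le> \<epsilon>" and \<alpha>: "0 < \<alpha>"
    and Q: "Q \<in> wasserstein_ball N X \<epsilon> (empirical \<xi>)"
    and bound: "\<And>\<zeta> i. \<zeta> \<in> X \<Longrightarrow> 0 \<le> lam * N (\<zeta> - \<xi> i) + r i"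
      "\<And>\<zeta> i. \<zeta> \<in> X \<Longrightarrow> l \<zeta> \<le> ereal (\<tau> + (lam * N (\<zeta> - \<xi> i) + r i))"
  shows "cvar \<alpha> Q l \<le> ereal (\<tau> + 1 / \<alpha> * (\<epsilon> * lam + 1 / real CARD('i) * (\<Sum>i\<in>UNIV. r i)))"
proof (rule ereal_le_epsilon2)
  fix e :: real assume "0 < e"
  \<comment> \<open>The excess cost changes the objective by
    \<open>lam * \<delta> / \<alpha>\<close>, which this choice keeps at most \<open>e\<close>; the
    denominator \<open>lam + 1\<close> also covers \<open>lam = 0\<close>.\<close>
  define \<delta> where "\<delta> = \<alpha> * e / (lam + 1)"
  have \<delta>: "0 < \<delta>" using \<open>0 < e\<close> \<alpha> lam by (simp add: \<delta>_def)
  have "wasserstein1 N Q (empirical \<xi>) < ennreal (\<epsilon> + \<delta>)"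
    using Q \<epsilon> \<delta> by (auto simp: wasserstein_ball_def ennreal_less_iff elim!: order.strict_trans1)
  then obtain P where P: "P \<in> couplings Q (empirical \<xi>)"
      "(\<integral>\<^sup>+ p. ennreal (N (fst p - snd p)) \<partial>P) < ennreal (\<epsilon> + \<delta>)"
    unfolding wasserstein1_def INF_less_iff by blast
  have "AE \<zeta> in Q. \<zeta> \<in> X" using Q by (simp add: wasserstein_ball_def distributions1_def)
  then have AE: "AE \<zeta> in Q. \<forall>i. 0 \<le> lam * N (\<zeta> - \<xi> i) + r i \<and>
      e2ennreal (max (l \<zeta> - ereal \<tau>) 0) \<le> ennreal (lam * N (\<zeta> - \<xi> i) + r i)"
  proof (eventually_elim, intro allI conjI)
    fix \<zeta> i assume "\<zeta> \<in> X"
    then show nn: "0 \<le> lam * N (\<zeta> - \<xi> i) + r i" by (rule bound)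
    have "max (l \<zeta> - ereal \<tau>) 0 \<le> ereal (lam * N (\<zeta> - \<xi> i) + r i)"
      using bound(2)[OF \<open>\<zeta> \<in> X\<close>, of i] nn by (cases "l \<zeta>") auto
    then show "e2ennreal (max (l \<zeta> - ereal \<tau>) 0) \<le> ennreal (lam * N (\<zeta> - \<xi> i) + r i)"
      by (metis e2ennreal_ereal e2ennreal_mono)
  qed
  let ?b = "lam * (\<epsilon> + \<delta>) + (\<Sum>i\<in>UNIV. r i) / real CARD('i)"
  let ?I = "\<integral>\<^sup>+ \<zeta>. e2ennreal (max (l \<zeta> - ereal \<tau>) 0) \<partial>Q"
  have b: "0 \<le> ?b" "?I \<le> ennreal ?b"
    using \<epsilon> \<delta> by (intro coupling_empirical_bound[OF N lam _ P(1) less_imp_le[OF P(2)] AE]; simp)+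
  have "enn2ereal ?I \<le> ereal ?b"
    using b by (metis enn2ereal_ennreal less_eq_ennreal.rep_eq)
  then have "ereal (1 / \<alpha>) * enn2ereal ?I \<le> ereal (1 / \<alpha>) * ereal ?b"
    using \<alpha> by (intro ereal_mult_left_mono) auto
  then have "ereal \<tau> + ereal (1 / \<alpha>) * enn2ereal ?I \<le> ereal \<tau> + ereal (1 / \<alpha>) * ereal ?b"
    by (rule add_left_mono)
  \<comment> \<open>The infimum defining \<open>cvar\<close> is bounded by its value at the variable
    \<open>\<tau>\<close> of the program.\<close>
  then have "cvar \<alpha> Q l \<le> ereal (\<tau> + 1 / \<alpha> * ?b)"
    unfolding cvar_def by (intro INF_lower2[of \<tau>]) auto
  also have "\<tau> + 1 / \<alpha> * ?b \<le> \<tau> + 1 / \<alpha> * (\<epsilon> * lam + 1 / real CARD('i) * (\<Sum>i\<in>UNIV. r i)) + e"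
  proof -
    have "lam * \<delta> / \<alpha> = e * (lam / (lam + 1))" using \<alpha> by (simp add: \<delta>_def)
    also have "\<dots> \<le> e * 1" using \<open>0 < e\<close> lam by (intro mult_left_mono) auto
    finally show ?thesis by (simp add: algebra_simps add_divide_distrib)
  qed
  finally show "cvar \<alpha> Q l \<le> ereal (\<tau> + 1 / \<alpha> * (\<epsilon> * lam + 1 / real CARD('i) * (\<Sum>i\<in>UNIV. r i))) + ereal e"
    by simp
qed

section \<open>Affine majorant of the loss, and safety of the program\<close>

text \<open>Each \<open>y\<close> in the response set satisfies the same dual lower bound. The
  estimate also covers an empty response set, where the infimum is infinite and the loss is minus
  infinity.\<close>

lemma subopt_loss_le:
  assumes z: "\<And>j x. z $ j \<bullet> x - \<theta> $ j * \<Psi> x $ j \<le> c j" "(\<Sum>j\<in>UNIV. z $ j) = transpose W *v \<gamma>"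
    and \<gamma>: "\<gamma> \<in> dual_cone K"
  shows "subopt_loss (hypothesis_fun \<Psi> \<theta>) (responses W H h K) (s, x)
    \<le> ereal (\<theta> \<bullet> \<Psi> x + (\<Sum>j\<in>UNIV. c j) - \<gamma> \<bullet> (H *v s + h))"
proof -
  have "ereal (\<gamma> \<bullet> (H *v s + h) - (\<Sum>j\<in>UNIV. c j))
      \<le> (INF y\<in>responses W H h K s. ereal (hypothesis_fun \<Psi> \<theta> s y))"
  proof (rule INF_greatest)
    fix y assume "y \<in> responses W H h K s"
    then have "\<gamma> \<bullet> (H *v s + h) \<le> \<gamma> \<bullet> (W *v y)"
      using \<gamma> by (auto simp: responses_def dual_cone_def inner_diff_right)
    also have "\<dots> = (\<Sum>j\<in>UNIV. z $ j) \<bullet> y"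
      by (simp add: z(2) dot_lmul_matrix)
    also have "\<dots> = (\<Sum>j\<in>UNIV. z $ j \<bullet> y)" by (rule inner_sum_left)
    also have "\<dots> \<le> (\<Sum>j\<in>UNIV. c j + \<theta> $ j * \<Psi> y $ j)"
      using z(1)[of _ y] by (intro sum_mono) (simp add: algebra_simps)
    also have "\<dots> = (\<Sum>j\<in>UNIV. c j) + \<theta> \<bullet> \<Psi> y"
      by (simp add: sum.distrib inner_vec_def)
    finally show "ereal (\<gamma> \<bullet> (H *v s + h) - (\<Sum>j\<in>UNIV. c j)) \<le> ereal (hypothesis_fun \<Psi> \<theta> s y)"
      by (simp add: hypothesis_fun_def)
  qed
  then have "ereal (\<theta> \<bullet> \<Psi> x) - (INF y\<in>responses W H h K s. ereal (hypothesis_fun \<Psi> \<theta> s y))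
      \<le> ereal (\<theta> \<bullet> \<Psi> x) - ereal (\<gamma> \<bullet> (H *v s + h) - (\<Sum>j\<in>UNIV. c j))"
    by (intro ereal_minus_mono order_refl)
  then show ?thesis by (simp add: subopt_loss_def hypothesis_fun_def algebra_simps)
qed

text \<open>The majorant of the loss has signal slope \<open>C^T \<phi>1 - H^T \<gamma>\<close>, the
  negative of the vector in the program. Flipping the norm in the signal component corrects this
  sign, so the argument works for every norm.\<close>

lemma safe_approximation_flip_fst:
  fixes \<Psi> :: "real^'n \<Rightarrow> real^'D" and shat :: "'N::finite \<Rightarrow> real^'m"
  assumes Nresp: "is_norm Nresp" and Nfeat: "is_norm Nfeat"
    and lip: "\<And>s1 x1 s2 x2. Nfeat ((s1, \<Psi> x1) - (s2, \<Psi> x2)) \<le> Nresp ((s1, x1) - (s2, x2))"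
    and \<Theta>: "\<Theta> \<subseteq> {\<theta>. \<forall>j. 0 \<le> \<theta> $ j}" and \<alpha>: "0 < \<alpha>" and \<epsilon>: "0 \<le> \<epsilon>"
  shows "safe_approximation \<Theta> (worst_case_risk C d CC W H h K \<Psi> Nresp shat xhat \<alpha> \<epsilon>)
    (feasible_set C d CC W H h K \<Psi> (flip_fst Nfeat) \<Theta> shat xhat) \<alpha> \<epsilon>"
  unfolding safe_approximation_def program_value_def worst_case_risk_def
proof (intro ballI INF_greatest SUP_least)
  fix \<theta> v Q
  assume "\<theta> \<in> \<Theta>" and v: "v \<in> {v. (\<theta>, v) \<in> feasible_set C d CC W H h K \<Psi> (flip_fst Nfeat) \<Theta> shat xhat}"
    and Q: "Q \<in> wasserstein_ball Nresp (support_set C d CC W H h K) \<epsilon> (empirical (\<lambda>i. (shat i, xhat i)))"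
  obtain lam \<tau> r \<phi>1 \<phi>2 \<gamma> z where v_eq: "v = (lam, \<tau>, r, \<phi>1, \<phi>2, \<gamma>, z)" by (cases v) auto
  note mem = v[unfolded v_eq feasible_set_def mem_Collect_eq prod.case]
  have nonneg: "0 \<le> \<theta> $ j" for j using \<open>\<theta> \<in> \<Theta>\<close> \<Theta> by blast
  \<comment> \<open>The dual norm bounds the increment in feature space, and \<open>lip\<close>
    multiplied by \<open>lam \<ge> 0\<close> transfers the bound to the response space, where the
    transport cost is measured.\<close>
  have slope: "(u, t) \<bullet> ((s, \<Psi> x) - (shat i, \<Psi> (xhat i))) \<le> lam * Nresp ((s, x) - (shat i, xhat i))"
    if "dual_norm Nfeat (u, t) \<le> lam" for u t s x i
    using that mult_left_mono[OF lip[of s x "shat i" "xhat i"], of lam] mem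
    unfolding dual_norm_le_iff[OF Nfeat] by (meson order_trans)
  have "cvar \<alpha> Q (subopt_loss (hypothesis_fun \<Psi> \<theta>) (responses W H h K))
      \<le> ereal (\<tau> + 1 / \<alpha> * (\<epsilon> * lam + 1 / real CARD('N) * (\<Sum>i\<in>UNIV. r $ i)))"
  proof (rule cvar_le_wasserstein_ball[OF Nresp _ \<epsilon> \<alpha> Q])
    show "0 \<le> lam" using mem by auto
  next
    fix \<zeta> and i
    assume "\<zeta> \<in> support_set C d CC W H h K"
    then obtain s x where \<zeta>: "\<zeta> = (s, x)" and s: "C *v s - d \<in> CC"
      by (auto simp: support_set_def)
    \<comment> \<open>The multiplier \<open>\<phi>2\<close> certifies that the bound is nonnegative
      on the support: \<open>\<phi>2 $ i \<bullet> (C *v s - d)\<close> is nonnegative there, at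
      most \<open>r $ i\<close> at the sample, and grows at most at rate \<open>lam\<close>. With a
      zero feature part, flipping amounts to negating the whole vector.\<close>
    have "dual_norm (flip_fst Nfeat) (transpose C *v (\<phi>2 $ i), 0) \<le> lam" using mem by auto
    then have "dual_norm Nfeat (transpose C *v (\<phi>2 $ i), 0) \<le> lam"
      using dual_norm_minus[OF Nfeat, of "(transpose C *v (\<phi>2 $ i), 0)"] by (simp add: dual_norm_flip_fst)
    from slope[OF this, of s x i]
    have "(transpose C *v (\<phi>2 $ i)) \<bullet> (s - shat i) \<le> lam * Nresp (\<zeta> - (shat i, xhat i))"
      by (simp add: \<zeta>)
    moreover have "0 \<le> \<phi>2 $ i \<bullet> (C *v s - d)" using mem s by (auto simp: dual_cone_def)
    moreover have "\<phi>2 $ i \<bullet> (C *v shat i - d) \<le> r $ i"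
      using mem inner_commute[of "\<phi>2 $ i" "C *v shat i - d"] by auto
    ultimately show "0 \<le> lam * Nresp (\<zeta> - (shat i, xhat i)) + r $ i"
      by (simp add: dot_lmul_matrix matrix_vector_mult_diff_distrib inner_diff_right)
    obtain c where c: "\<And>j x. z $ i $ j \<bullet> x - \<theta> $ j * \<Psi> x $ j \<le> c j"
        "(\<Sum>j\<in>UNIV. c j) + (\<theta> \<bullet> \<Psi> (xhat i) + \<phi>1 $ i \<bullet> (C *v shat i - d) - \<gamma> $ i \<bullet> (H *v shat i + h))
          \<le> r $ i + \<tau>"
      using iffD1[OF sum_conj_persp_le_iff[where t = "($) \<theta>" and z = "($) (z $ i)"
            and f = "\<lambda>j x. \<Psi> x $ j", OF nonneg], of _ "r $ i + \<tau>"] mem by blast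
    have "subopt_loss (hypothesis_fun \<Psi> \<theta>) (responses W H h K) \<zeta>
        \<le> ereal (\<theta> \<bullet> \<Psi> x + (\<Sum>j\<in>UNIV. c j) - \<gamma> $ i \<bullet> (H *v s + h))"
      unfolding \<zeta> using mem c(1) by (intro subopt_loss_le[of "z $ i"]) auto
    \<comment> \<open>Adding \<open>\<phi>1 $ i \<bullet> (C *v s - d) \<ge> 0\<close> gives a
      function affine in \<open>(s, \<Psi> x)\<close>. Its value at the sample is at most
      \<open>r $ i + \<tau>\<close> by \<open>c(2)\<close>, and \<open>slope\<close> bounds its
      increment.\<close>
    also have "\<theta> \<bullet> \<Psi> x + (\<Sum>j\<in>UNIV. c j) - \<gamma> $ i \<bullet> (H *v s + h)
        \<le> \<tau> + (lam * Nresp (\<zeta> - (shat i, xhat i)) + r $ i)"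
    proof -
      have "dual_norm Nfeat (- (transpose H *v (\<gamma> $ i) - transpose C *v (\<phi>1 $ i)), \<theta>) \<le> lam"
        using mem by (auto simp: dual_norm_flip_fst)
      from slope[OF this, of s x i]
      have "(transpose C *v (\<phi>1 $ i) - transpose H *v (\<gamma> $ i)) \<bullet> (s - shat i) + \<theta> \<bullet> (\<Psi> x - \<Psi> (xhat i))
          \<le> lam * Nresp (\<zeta> - (shat i, xhat i))"
        by (simp add: \<zeta>)
      moreover have "0 \<le> \<phi>1 $ i \<bullet> (C *v s - d)" using mem s by (auto simp: dual_cone_def)
      ultimately show ?thesis using c(2)
        by (simp add: dot_lmul_matrix matrix_vector_mult_diff_distrib inner_diff_right inner_diff_left inner_add_right)
    qed
    finally show "subopt_loss (hypothesis_fun \<Psi> \<theta>) (responses W H h K) \<zeta>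
        \<le> ereal (\<tau> + (lam * Nresp (\<zeta> - (shat i, xhat i)) + r $ i))" by simp
  qed
  then show "cvar \<alpha> Q (subopt_loss (hypothesis_fun \<Psi> \<theta>) (responses W H h K)) \<le> ereal (objective \<alpha> \<epsilon> (\<theta>, v))"
    by (simp add: v_eq objective_def)
qed

theorem theoremA1:
  fixes C :: "real^'m^'p" and d :: "real^'p" and CC :: "(real^'p) set"
    and W :: "real^'n^'q" and H :: "real^'m^'q" and h :: "real^'q" and K :: "(real^'q) set"
    and \<Psi> :: "real^'n \<Rightarrow> real^'D" and \<Theta> :: "(real^'D) set"
    and Nresp :: "(real^'m) \<times> (real^'n) \<Rightarrow> real" and Nfeat :: "(real^'m) \<times> (real^'D) \<Rightarrow> real"
    and shat :: "'N::finite \<Rightarrow> real^'m" and xhat :: "'N \<Rightarrow> real^'n"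
    and \<alpha> \<epsilon> :: real
  assumes "proper_cone CC" and "proper_cone K"
    and "has_slater_point C d CC W H h K"
    and "is_norm Nresp" and "is_norm Nfeat"
    and "\<And>j. convex_on UNIV (\<lambda>x. \<Psi> x $ j)"
    and "\<And>s1 x1 s2 x2.
      Nfeat ((s1, \<Psi> x1) - (s2, \<Psi> x2)) \<le> Nresp ((s1, x1) - (s2, x2))"
    and "convex \<Theta>" and "closed \<Theta>" and "\<Theta> \<subseteq> {\<theta>. \<forall>j. 0 \<le> \<theta> $ j}"
    and "0 < \<alpha>" and "\<alpha> \<le> 1" and "0 \<le> \<epsilon>"
  shows
    "(convex_on (feasible_set C d CC W H h K \<Psi> Nfeat \<Theta> shat xhat) (objective \<alpha> \<epsilon>) \<and>
      ((\<forall>u v. Nfeat (- u, v) = Nfeat (u, v)) \<longrightarrow>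
        safe_approximation \<Theta> (worst_case_risk C d CC W H h K \<Psi> Nresp shat xhat \<alpha> \<epsilon>)
          (feasible_set C d CC W H h K \<Psi> Nfeat \<Theta> shat xhat) \<alpha> \<epsilon>)) \<and>
     (convex_on (feasible_set C d CC W H h K \<Psi> (flip_fst Nfeat) \<Theta> shat xhat) (objective \<alpha> \<epsilon>) \<and>
      safe_approximation \<Theta> (worst_case_risk C d CC W H h K \<Psi> Nresp shat xhat \<alpha> \<epsilon>)
        (feasible_set C d CC W H h K \<Psi> (flip_fst Nfeat) \<Theta> shat xhat) \<alpha> \<epsilon>)"
proof -
  note safe = safe_approximation_flip_fst[OF assms(4,5,7,10,11,13)]
  \<comment> \<open>For an invariant norm the flipped and the original program coincide, so safety
    carries over.\<close>
  have "flip_fst Nfeat = Nfeat" if "\<forall>u v. Nfeat (- u, v) = Nfeat (u, v)"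
    using that by (auto simp: flip_fst_def)
  then show ?thesis
    using safe convex_on_objective[OF convex_feasible_set[OF assms(5,8,10)]]
      convex_on_objective[OF convex_feasible_set[OF is_norm_flip_fst[OF assms(5)] assms(8,10)]]
    by metis
qed

end
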